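(* Let $\Gamma$ be a group and let $M$ be a locally compact, Hausdorff space on which $\Gamma$ acts by homeomorphisms. Let $\mathcal{Y}\subseteq 2^M$ be a minimal, closed, $\Gamma$-invariant subset such that all elements of $\mathcal{Y}$ are compact subsets of $M$. If $\mathcal{Y}$ contains an element with finitely many connected components, then $\bigcup\mathcal{Y}$ has compact closure in $M$.
   Context: For a locally compact Hausdorff space $M$, $2^M$ denotes the set of all closed subsets of $M$ (including $\emptyset$), with the Chabauty (Fell) topology, i.e. the topology with subbasis consisting of the sets $\{A\in 2^M : A\cap U\neq\emptyset\}$ for $U\subseteq M$ open and $\{A\in 2^M : A\cap K=\emptyset\}$ for $K\subseteq M$ compact. The space $2^M$ is compact, and an action of $\Gamma$ on $M$ by homeomorphisms induces an action on $2^M$ by homeomorphisms, $A\mapsto gA$. A closed $\Gamma$-invariant subset $\mathcal{Y}\subseteq 2^M$ is minimal if it is non-empty and has no non-empty, proper, closed, $\Gamma$-invariant subset (equivalently, it is non-empty and every $\Gamma$-orbit in $\mathcal{Y}$ is dense in $\mathcal{Y}$). $\bigcup\mathcal{Y}$ denotes $\{x\in M : x\in Y \text{ for some } Y\in\mathcal{Y}\}$. *)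

theory Defs
  imports "HOL-Analysis.Analysis" "HOL-Algebra.Group_Action"
begin

definition chabauty_topology :: "'a topology \<Rightarrow> 'a set topology" where
  "chabauty_topology M = topology_generated_by
     ({{A. closedin M A \<and> A \<inter> U \<noteq> {}} | U. openin M U} \<union>
      {{A. closedin M A \<and> A \<inter> K = {}} | K. compactin M K})"

lemma topspace_chabauty_topology:
  "topspace (chabauty_topology M) = {A. closedin M A}"
proof -
  have "{A. closedin M A} \<in> {{A. closedin M A \<and> A \<inter> K = {}} | K. compactin M K}"
    using compactin_empty[of M] by force
  then show ?thesis
    unfolding chabauty_topology_def topology_generated_by_topspace by blast
qed

locale action_by_homeomorphisms =
  group_action \<Gamma> "topspace M" \<phi>
  for \<Gamma> :: "('g, 'r) monoid_scheme" (structure)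
    and M :: "'a topology"
    and \<phi> :: "'g \<Rightarrow> 'a \<Rightarrow> 'a" +
  assumes homeomorphic: "g \<in> carrier \<Gamma> \<Longrightarrow> homeomorphic_map M M (\<phi> g)"

text \<open>Invariance is for the induced action on closed sets, which sends \<open>A\<close> to \<open>\<phi> g ` A\<close>.\<close>

definition closed_invariant ::
  "('g, 'r) monoid_scheme \<Rightarrow> 'a topology \<Rightarrow> ('g \<Rightarrow> 'a \<Rightarrow> 'a) \<Rightarrow> 'a set set \<Rightarrow> bool" where
  "closed_invariant \<Gamma> M \<phi> \<Y> \<longleftrightarrow>
     closedin (chabauty_topology M) \<Y> \<and>
     (\<forall>g \<in> carrier \<Gamma>. \<forall>A \<in> \<Y>. \<phi> g ` A \<in> \<Y>)"

definition minimal_closed_invariant ::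
  "('g, 'r) monoid_scheme \<Rightarrow> 'a topology \<Rightarrow> ('g \<Rightarrow> 'a \<Rightarrow> 'a) \<Rightarrow> 'a set set \<Rightarrow> bool" where
  "minimal_closed_invariant \<Gamma> M \<phi> \<Y> \<longleftrightarrow>
     closed_invariant \<Gamma> M \<phi> \<Y> \<and> \<Y> \<noteq> {} \<and>
     \<not> (\<exists>\<Z>. \<Z> \<noteq> {} \<and> \<Z> \<subset> \<Y> \<and> closed_invariant \<Gamma> M \<phi> \<Z>)"

end

theory Submission
  imports Defs
begin

text \<open>
  Enclose the finitely many components \<open>C\<close> of some \<open>Y\<^sub>0 \<in> \<Y>\<close> in disjoint open sets \<open>U C\<close> lying in a
  compact set \<open>K\<close>, and let \<open>N\<close> be the Chabauty neighbourhood of \<open>Y\<^sub>0\<close> consisting of the closed sets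
  that meet every \<open>U C\<close> and miss every frontier of a \<open>U C\<close>. If a translate \<open>g Y\<^sub>0\<close> lies in \<open>N\<close>, each
  of its components lies inside any \<open>U C\<close> that it meets; by counting, every component lies in some
  \<open>U C\<close>, so \<open>g Y\<^sub>0 \<subseteq> K\<close>. Minimality makes the orbit of \<open>Y\<^sub>0\<close> dense in \<open>\<Y>\<close>, so all members of
  \<open>\<Y> \<inter> N\<close> lie in \<open>K\<close>. Minimality and compactness of \<open>2\<^sup>M\<close> yield finitely many translates of \<open>N\<close>
  covering \<open>\<Y>\<close>, hence finitely many translates of \<open>K\<close> covering \<open>\<Union>\<Y>\<close>.
\<close>

section \<open>Compactness of the Chabauty space\<close>

text \<open>Bridges two encodings: \<open>chabauty_topology\<close> is built with
  \<open>topology_generated_by\<close>, whereas \<open>Alexander_subbase\<close> expects the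
  explicit form on the right.\<close>

lemma topology_generated_by_eq_subbase:
  "topology_generated_by \<B> =
     topology (arbitrary union_of (finite intersection_of (\<lambda>x. x \<in> \<B>) relative_to \<Union>\<B>))"
    (is "?S = ?T")
proof (rule topology_eq[THEN iffD2], intro allI iffI)
  fix s
  assume "openin ?T s"
  then show "openin ?S s"
    by (rule minimal_topology_subbase[rotated -1])
      (auto intro: topology_generated_by_Basis simp flip: topology_generated_by_topspace)
next
  fix s
  assume "openin ?S s"
  then have "generate_topology_on \<B> s"
    by (rule openin_topology_generated_by)
  then show "openin ?T s"
  proof induction
    case (Basis s)
    then have "(finite intersection_of (\<lambda>x. x \<in> \<B>) relative_to \<Union>\<B>) s"
      by (metis Sup_upper finite_intersection_of_inc inf.absorb2 relative_to_def)
    then show ?case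
      by (simp add: openin_subbase arbitrary_union_of_inc)
  qed auto
qed

lemma openin_chabauty_hit:
  "openin M U \<Longrightarrow> openin (chabauty_topology M) {A. closedin M A \<and> A \<inter> U \<noteq> {}}"
  unfolding chabauty_topology_def by (rule topology_generated_by_Basis) blast

lemma openin_chabauty_miss:
  "compactin M K \<Longrightarrow> openin (chabauty_topology M) {A. closedin M A \<and> A \<inter> K = {}}"
  unfolding chabauty_topology_def by (rule topology_generated_by_Basis) blast

text \<open>By Alexander's theorem only covers by subbasic sets matter, and one miss set together
  with finitely many hit sets already suffices.\<close>

lemma compact_space_chabauty_topology: "compact_space (chabauty_topology M)"
proof -
  define hit where "hit U = {A. closedin M A \<and> A \<inter> U \<noteq> {}}" for U
  define miss where "miss K = {A. closedin M A \<and> A \<inter> K = {}}" for K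
  let ?B = "{hit U | U. openin M U} \<union> {miss K | K. compactin M K}"
  show ?thesis
  proof (rule Alexander_subbase)
    show "topology (arbitrary union_of (finite intersection_of (\<lambda>x. x \<in> ?B) relative_to \<Union>?B))
            = chabauty_topology M"
      unfolding chabauty_topology_def hit_def miss_def
      by (rule topology_generated_by_eq_subbase[symmetric])
  next
    fix \<C>
    assume \<C>: "\<C> \<subseteq> ?B" and cover: "\<Union>\<C> = topspace (chabauty_topology M)"
    define \<U> where "\<U> = {U. openin M U \<and> hit U \<in> \<C>}"
    txt \<open>The largest closed set avoiding all the open sets of hit type can only be covered by a set of
      miss type.\<close>
    define A where "A = topspace M - \<Union>\<U>"
    have "closedin M A"
      unfolding A_def \<U>_def by blast
    then obtain c where c: "c \<in> \<C>" "A \<in> c"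
      using cover unfolding topspace_chabauty_topology by blast
    have "c \<noteq> hit U" if "openin M U" for U
      using c that unfolding A_def \<U>_def hit_def by blast
    moreover have "c \<in> ?B"
      using \<C> c(1) by (rule subsetD)
    ultimately obtain K where K: "compactin M K" "c = miss K"
      by blast
    have opU: "openin M U" if "U \<in> \<U>" for U
      using that unfolding \<U>_def by simp
    have "K \<subseteq> \<Union>\<U>"
      using c(2) K compactin_subset_topspace[OF K(1)] unfolding A_def miss_def by blast
    then obtain \<V> where \<V>: "finite \<V>" "\<V> \<subseteq> \<U>" "K \<subseteq> \<Union>\<V>"
      using compactinD[OF K(1) opU] by metis
    show "\<exists>\<C>'. finite \<C>' \<and> \<C>' \<subseteq> \<C> \<and> \<Union>\<C>' = topspace (chabauty_topology M)"
    proof (intro exI conjI)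
      show "finite (insert c (hit ` \<V>))"
        using \<V>(1) by simp
      show sub: "insert c (hit ` \<V>) \<subseteq> \<C>"
        using c(1) \<V>(2) unfolding \<U>_def by blast
      \<comment> \<open>Either \<open>B\<close> avoids \<open>K\<close> and lies in
        \<open>c\<close>, or it meets \<open>K\<close> and hence some member of
        \<open>\<V>\<close>.\<close>
      have "B \<in> \<Union>(insert c (hit ` \<V>))" if "closedin M B" for B
        using that \<V>(3) unfolding K(2) hit_def miss_def by auto
      moreover have "\<Union>(insert c (hit ` \<V>)) \<subseteq> topspace (chabauty_topology M)"
        using Union_mono[OF sub] cover by simp
      ultimately show "\<Union>(insert c (hit ` \<V>)) = topspace (chabauty_topology M)"
        unfolding topspace_chabauty_topology by blast
    qed
  qed
qed

section \<open>The induced action\<close>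

lemma continuous_map_chabauty_image:
  assumes "homeomorphic_map M M f"
  shows "continuous_map (chabauty_topology M) (chabauty_topology M) ((`) f)"
proof -
  obtain h where "homeomorphic_maps M M f h"
    using assms homeomorphic_map_maps by blast
  then have h: "homeomorphic_map M M h"
    and hf: "\<And>x. x \<in> topspace M \<Longrightarrow> h (f x) = x" and fh: "\<And>x. x \<in> topspace M \<Longrightarrow> f (h x) = x"
    by (auto simp: homeomorphic_maps_map)
  have closed: "closedin M (f ` A)" if "closedin M A" for A
    using that assms by (meson homeomorphic_map_closedness_eq)
  have meets: "f ` A \<inter> V = {} \<longleftrightarrow> A \<inter> h ` V = {}" if "closedin M A" "V \<subseteq> topspace M" for A V
  proof -
    have "f x \<in> V \<longleftrightarrow> x \<in> h ` V" if "x \<in> A" for x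
      using hf[of x] fh \<open>V \<subseteq> topspace M\<close> closedin_subset[OF \<open>closedin M A\<close>] that
      by (metis imageE imageI subsetD)
    then show ?thesis
      by blast
  qed
  let ?B = "{{A. closedin M A \<and> A \<inter> U \<noteq> {}} | U. openin M U} \<union>
            {{A. closedin M A \<and> A \<inter> K = {}} | K. compactin M K}"
  have "continuous_map (chabauty_topology M) (topology_generated_by ?B) ((`) f)"
  proof (rule continuous_on_generated_topo)
    fix W
    assume "W \<in> ?B"
    then consider U where "openin M U" "W = {A. closedin M A \<and> A \<inter> U \<noteq> {}}"
      | K where "compactin M K" "W = {A. closedin M A \<and> A \<inter> K = {}}"
      by blast
    then show "openin (chabauty_topology M) ((`) f -` W \<inter> topspace (chabauty_topology M))"
    proof cases
      case 1
      have "(`) f -` W \<inter> topspace (chabauty_topology M) = {A. closedin M A \<and> A \<inter> h ` U \<noteq> {}}"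
        using closed meets[OF _ openin_subset[OF 1(1)]]
        unfolding 1(2) topspace_chabauty_topology vimage_def
        by (simp cong: conj_cong add: Collect_conj_eq[symmetric] conj_commute)
      moreover have "openin M (h ` U)"
        using 1(1) h by (meson homeomorphic_map_openness_eq)
      ultimately show ?thesis
        by (metis openin_chabauty_hit)
    next
      case 2
      have "(`) f -` W \<inter> topspace (chabauty_topology M) = {A. closedin M A \<and> A \<inter> h ` K = {}}"
        using closed meets[OF _ compactin_subset_topspace[OF 2(1)]]
        unfolding 2(2) topspace_chabauty_topology vimage_def
        by (simp cong: conj_cong add: Collect_conj_eq[symmetric] conj_commute)
      moreover have "compactin M (h ` K)"
        using 2(1) h by (meson homeomorphic_map_compactness_eq)
      ultimately show ?thesis
        by (metis openin_chabauty_miss)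
    qed
  next
    show "(`) f ` topspace (chabauty_topology M) \<subseteq> \<Union>?B"
      using closed topspace_chabauty_topology[of M]
      unfolding chabauty_topology_def topology_generated_by_topspace by blast
  qed
  then show ?thesis
    by (simp flip: chabauty_topology_def)
qed

section \<open>Orbits and finite covers in a minimal set\<close>

context action_by_homeomorphisms
begin

lemma openin_chabauty_translate:
  assumes "g \<in> carrier \<Gamma>" and "openin (chabauty_topology M) N"
  shows "openin (chabauty_topology M) {A. closedin M A \<and> \<phi> g ` A \<in> N}"
  using openin_continuous_map_preimage
      [OF continuous_map_chabauty_image[OF homeomorphic[OF assms(1)]] assms(2)]
  by (simp add: topspace_chabauty_topology)

text \<open>This is density of orbits: the members of \<open>\<Y>\<close> whose orbit avoids
  \<open>N\<close> form a closed invariant proper subset, which minimality forces to be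
  empty.\<close>

lemma minimal_meets_open:
  assumes min: "minimal_closed_invariant \<Gamma> M \<phi> \<Y>"
    and N: "openin (chabauty_topology M) N" "N \<inter> \<Y> \<noteq> {}"
    and Y: "Y \<in> \<Y>"
  shows "\<exists>g \<in> carrier \<Gamma>. \<phi> g ` Y \<in> N"
proof (rule ccontr)
  interpret group \<Gamma>
    using group_hom group_hom.axioms(1) by auto
  assume contra: "\<not> ?thesis"
  let ?V = "\<Union>g \<in> carrier \<Gamma>. {A. closedin M A \<and> \<phi> g ` A \<in> N}"
  define \<Z> where "\<Z> = \<Y> - ?V"
  have inv: "closed_invariant \<Gamma> M \<phi> \<Y>"
    using min by (simp add: minimal_closed_invariant_def)
  have closed: "closedin M A" if "A \<in> \<Y>" for A
    using inv that closedin_subset topspace_chabauty_topology unfolding closed_invariant_def by blast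
  have "openin (chabauty_topology M) ?V"
    using openin_chabauty_translate[OF _ N(1)] by blast
  then have "closedin (chabauty_topology M) \<Z>"
    unfolding \<Z>_def using inv by (simp add: closed_invariant_def closedin_diff)
  moreover have "\<phi> h ` A \<in> \<Z>" if "h \<in> carrier \<Gamma>" "A \<in> \<Z>" for h A
  proof -
    have A: "A \<in> \<Y>" "A \<subseteq> topspace M"
      using that(2) closed closedin_subset unfolding \<Z>_def by auto
    have "\<phi> g ` \<phi> h ` A \<notin> N" if g: "g \<in> carrier \<Gamma>" for g
    proof -
      have "\<phi> g ` \<phi> h ` A = \<phi> (g \<otimes> h) ` A"
        unfolding image_image
        by (rule image_cong) (use A composition_rule g \<open>h \<in> carrier \<Gamma>\<close> in auto)
      moreover have "g \<otimes> h \<in> carrier \<Gamma>"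
        using g \<open>h \<in> carrier \<Gamma>\<close> by simp
      ultimately show ?thesis
        using \<open>A \<in> \<Z>\<close> A(1) closed unfolding \<Z>_def by auto
    qed
    then show ?thesis
      using inv A(1) \<open>h \<in> carrier \<Gamma>\<close> unfolding \<Z>_def closed_invariant_def by auto
  qed
  ultimately have "closed_invariant \<Gamma> M \<phi> \<Z>"
    by (simp add: closed_invariant_def)
  moreover have "Y \<in> \<Z>"
    using Y contra unfolding \<Z>_def by blast
  moreover have "\<Z> \<subset> \<Y>"
  proof -
    obtain A where A: "A \<in> N" "A \<in> \<Y>"
      using N(2) by blast
    \<comment> \<open>The unit translate already brings \<open>A\<close> into \<open>N\<close>, so
      \<open>A\<close> witnesses that \<open>\<Z>\<close> is proper.\<close>
    have "\<phi> \<one> ` A = A"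
      using closedin_subset[OF closed[OF A(2)]] by (auto simp flip: id_eq_one simp: image_iff)
    then have "A \<in> {A. closedin M A \<and> \<phi> \<one> ` A \<in> N}"
      using A closed by simp
    then have "A \<notin> \<Z>"
      using one_closed unfolding \<Z>_def by blast
    then show ?thesis
      using A(2) unfolding \<Z>_def by blast
  qed
  ultimately show False
    using min unfolding minimal_closed_invariant_def by blast
qed

text \<open>Every orbit enters \<open>N\<close>, so the open sets \<open>T g\<close> cover the
  compact set \<open>\<Y>\<close>; a finite subcover turns the bound \<open>K\<close> into a bound
  for all of \<open>\<Y>\<close>.\<close>

lemma compactin_closure_of_Union:
  assumes "Hausdorff_space M"
    and min: "minimal_closed_invariant \<Gamma> M \<phi> \<Y>"
    and N: "openin (chabauty_topology M) N" "N \<inter> \<Y> \<noteq> {}"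
    and K: "compactin M K" "\<And>A. A \<in> N \<inter> \<Y> \<Longrightarrow> A \<subseteq> K"
  shows "compactin M (M closure_of \<Union>\<Y>)"
proof -
  interpret group \<Gamma>
    using group_hom group_hom.axioms(1) by auto
  define T where "T g = {A. closedin M A \<and> \<phi> g ` A \<in> N}" for g
  have inv: "closed_invariant \<Gamma> M \<phi> \<Y>"
    using min by (simp add: minimal_closed_invariant_def)
  have closed: "closedin M A" if "A \<in> \<Y>" for A
    using inv that closedin_subset topspace_chabauty_topology unfolding closed_invariant_def by blast
  have "compactin (chabauty_topology M) \<Y>"
    using inv unfolding closed_invariant_def
    by (intro closedin_compact_space[OF compact_space_chabauty_topology]) blast
  moreover have "\<Y> \<subseteq> \<Union>(T ` carrier \<Gamma>)"
    using minimal_meets_open[OF min N] closed unfolding T_def by blast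
  moreover have "\<And>V. V \<in> T ` carrier \<Gamma> \<Longrightarrow> openin (chabauty_topology M) V"
    using openin_chabauty_translate[OF _ N(1)] unfolding T_def by blast
  ultimately obtain \<F> where \<F>: "finite \<F>" "\<F> \<subseteq> T ` carrier \<Gamma>" "\<Y> \<subseteq> \<Union>\<F>"
    by (meson compactinD)
  then obtain F where F: "finite F" "F \<subseteq> carrier \<Gamma>" "\<Y> \<subseteq> \<Union>(T ` F)"
    using finite_subset_image[OF \<F>(1,2)] by blast
  define L where "L = (\<Union>g \<in> F. \<phi> (inv g) ` K)"
  have "compactin M (\<phi> (inv g) ` K)" if "g \<in> F" for g
    using homeomorphic[of "inv g"] F(2) K(1) that
    by (meson homeomorphic_map_compactness_eq inv_closed subsetD)
  then have L: "compactin M L"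
    unfolding L_def using F(1) by (intro compactin_Union) auto
  have "A \<subseteq> L" if A: "A \<in> \<Y>" for A
  proof
    fix x assume x: "x \<in> A"
    obtain g where g: "g \<in> F" "\<phi> g ` A \<in> N"
      using F(3) A unfolding T_def by blast
    have "\<phi> g ` A \<in> \<Y>"
      using inv A g(1) F(2) unfolding closed_invariant_def by blast
    then have "\<phi> g x \<in> K"
      using K(2) g(2) x by blast
    moreover have "\<phi> (inv g) (\<phi> g x) = x"
      using orbit_sym_aux g(1) F(2) x closedin_subset[OF closed[OF A]] by blast
    ultimately show "x \<in> L"
      unfolding L_def using g(1) by (metis UN_I imageI)
  qed
  then have "M closure_of \<Union>\<Y> \<subseteq> L"
    using compactin_imp_closedin[OF assms(1) L] by (intro closure_of_minimal) blast+
  then show ?thesis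
    using L closed_compactin closedin_closure_of by blast
qed

end

section \<open>Separating the components\<close>

text \<open>Induction: the new compact set is separated from the compact union of the others, whose
  neighbourhoods are then cut down to the second separating set \<open>Q\<close>.\<close>

lemma Hausdorff_space_disjoint_compact_family:
  assumes "Hausdorff_space X" and "finite \<F>" and "\<And>C. C \<in> \<F> \<Longrightarrow> compactin X C"
    and "pairwise disjnt \<F>"
  shows "\<exists>U. (\<forall>C \<in> \<F>. openin X (U C) \<and> C \<subseteq> U C) \<and> disjoint_family_on U \<F>"
  using assms(2-4)
proof (induction \<F> rule: finite_induct)
  case empty
  then show ?case
    by (simp add: disjoint_family_on_def)
next
  case (insert C \<F>)
  obtain U where U: "\<And>D. D \<in> \<F> \<Longrightarrow> openin X (U D) \<and> D \<subseteq> U D" "disjoint_family_on U \<F>"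
    using insert.IH insert.prems unfolding pairwise_insert by (metis insertCI)
  have "disjnt C (\<Union>\<F>)"
    using insert.prems(2) insert.hyps(2) by (auto simp: pairwise_insert disjnt_Union2)
  moreover have "compactin X (\<Union>\<F>)" "compactin X C"
    using insert.hyps(1) insert.prems(1) by (simp_all add: compactin_Union)
  ultimately obtain P Q where PQ: "openin X P" "openin X Q" "C \<subseteq> P" "\<Union>\<F> \<subseteq> Q" "disjnt P Q"
    using assms(1) unfolding Hausdorff_space_compact_sets by metis
  define U' where "U' D = (if D = C then P else U D \<inter> Q)" for D
  have "openin X (U' D) \<and> D \<subseteq> U' D" if "D \<in> insert C \<F>" for D
  proof (cases "D = C")
    case False
    then have "D \<in> \<F>"
      using that by blast
    with False show ?thesis
      using U(1) PQ(2,4) unfolding U'_def by (simp add: openin_Int Sup_le_iff)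
  qed (use PQ in \<open>simp add: U'_def\<close>)
  moreover have "disjoint_family_on U' (insert C \<F>)"
  proof -
    have "U' C \<inter> (\<Union>D \<in> \<F>. U' D) = {}"
      using PQ(5) insert.hyps(2) unfolding U'_def disjnt_def by (auto split: if_splits)
    moreover have "disjoint_family_on U' \<F>"
      by (rule disjoint_family_on_bisimulation[OF U(2)]) (use insert.hyps(2) in \<open>auto simp: U'_def\<close>)
    ultimately show ?thesis
      using insert.hyps(2) by (simp add: disjoint_family_on_insert)
  qed
  ultimately show ?case
    by metis
qed

text \<open>The assignment of a piece \<open>f ` C\<close> meeting \<open>U D\<close> to \<open>D\<close> is injective, hence
  onto.\<close>

lemma image_Union_subset_Union_of_frontiers:
  assumes "finite \<F>"
    and U: "disjoint_family_on U \<F>"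
    and conn: "\<And>C. C \<in> \<F> \<Longrightarrow> connectedin X (f ` C)" and ne: "{} \<notin> \<F>"
    and meets: "\<And>D. D \<in> \<F> \<Longrightarrow> f ` \<Union>\<F> \<inter> U D \<noteq> {}"
    and misses: "\<And>D. D \<in> \<F> \<Longrightarrow> f ` \<Union>\<F> \<inter> X frontier_of U D = {}"
  shows "f ` \<Union>\<F> \<subseteq> \<Union>(U ` \<F>)"
proof -
  have "\<exists>C \<in> \<F>. f ` C \<subseteq> U D" if D: "D \<in> \<F>" for D
  proof -
    obtain C where C: "C \<in> \<F>" "f ` C \<inter> U D \<noteq> {}"
      using meets[OF D] by blast
    have "f ` C \<inter> X frontier_of U D = {}"
      using misses[OF D] C(1) by blast
    \<comment> \<open>A connected set that meets \<open>U D\<close> and misses its frontier cannot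
      leave \<open>U D\<close>.\<close>
    then show ?thesis
      using connectedin_Int_frontier_of[OF conn[OF C(1)] C(2)] C(1) by blast
  qed
  then obtain c where c: "\<And>D. D \<in> \<F> \<Longrightarrow> c D \<in> \<F> \<and> f ` c D \<subseteq> U D"
    by metis
  have "inj_on c \<F>"
  proof (rule inj_onI, rule ccontr)
    fix D E assume D: "D \<in> \<F>" and E: "E \<in> \<F>" and eq: "c D = c E" and "D \<noteq> E"
    then have "U D \<inter> U E = {}"
      using U by (simp add: disjoint_family_on_def)
    then have "f ` c D = {}"
      using c[OF D] c[OF E] unfolding eq by blast
    then show False
      using c[OF D] ne by auto
  qed
  \<comment> \<open>Finiteness of \<open>\<F>\<close> enters here: an injective self-map of a finite
    set is onto, so no piece is left outside the sets \<open>U D\<close>.\<close>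
  then have "c ` \<F> = \<F>"
    using assms(1) c by (intro endo_inj_surj) auto
  then have "\<Union>\<F> = (\<Union>D \<in> \<F>. c D)"
    by simp
  then have "f ` \<Union>\<F> = (\<Union>D \<in> \<F>. f ` c D)"
    by (simp add: image_UN)
  then show ?thesis
    using c by blast
qed

section \<open>The neighbourhood of a member with finitely many components\<close>

theorem theorem4p1:
  fixes \<Gamma> :: "('g, 'r) monoid_scheme"
    and M :: "'a topology"
    and \<phi> :: "'g \<Rightarrow> 'a \<Rightarrow> 'a"
    and \<Y> :: "'a set set"
  assumes "locally_compact_space M" and "Hausdorff_space M"
    and "action_by_homeomorphisms \<Gamma> M \<phi>"
    and "minimal_closed_invariant \<Gamma> M \<phi> \<Y>"
    and "\<And>Y. Y \<in> \<Y> \<Longrightarrow> compactin M Y"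
    and "\<exists>Y \<in> \<Y>. finite (connected_components_of (subtopology M Y))"
  shows "compactin M (M closure_of (\<Union>\<Y>))"
proof -
  interpret action_by_homeomorphisms \<Gamma> M \<phi>
    by (rule assms(3))
  obtain Y where Y: "Y \<in> \<Y>" and fin: "finite (connected_components_of (subtopology M Y))"
    using assms(6) by blast
  define \<F> where "\<F> = connected_components_of (subtopology M Y)"
  have cY: "compactin M Y"
    using assms(5) Y by blast
  then have YM: "Y \<subseteq> topspace M"
    by (rule compactin_subset_topspace)
  have finF: "finite \<F>" and ne: "{} \<notin> \<F>" and UnF: "\<Union>\<F> = Y"
    using fin YM Union_connected_components_of[of "subtopology M Y"]
      nonempty_connected_components_of[of _ "subtopology M Y"]
    unfolding \<F>_def by auto
  have conn: "connectedin M C" if "C \<in> \<F>" for C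
    using that connectedin_connected_components_of[of C "subtopology M Y"]
    by (simp add: \<F>_def connectedin_subtopology)
  have "compactin M C" if "C \<in> \<F>" for C
    using that cY closedin_connected_components_of[of C "subtopology M Y"] unfolding \<F>_def
    by (metis closedin_compact_space compact_space_subtopology compactin_subtopology)
  moreover have "pairwise disjnt \<F>"
    unfolding \<F>_def by (rule pairwise_disjoint_connected_components_of)
  ultimately obtain U0 where U0: "\<And>C. C \<in> \<F> \<Longrightarrow> openin M (U0 C) \<and> C \<subseteq> U0 C"
    and dis0: "disjoint_family_on U0 \<F>"
    using Hausdorff_space_disjoint_compact_family[OF assms(2) finF] by metis
  obtain W K where W: "openin M W" "Y \<subseteq> W" and K: "compactin M K" "closedin M K" "W \<subseteq> K"
    using assms(1,2) cY locally_compact_space_compact_closed_compact[of M] by metis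
  \<comment> \<open>Cutting down to \<open>W\<close> keeps the closures inside \<open>K\<close>, so
    the frontiers are compact and missing them is an open condition.\<close>
  define U where "U C = U0 C \<inter> W" for C
  have oU: "openin M (U C)" and CU: "C \<subseteq> U C" and UK: "U C \<subseteq> K" if "C \<in> \<F>" for C
    using U0[OF that] W K(3) UnF that unfolding U_def by auto
  have disU: "disjoint_family_on U \<F>"
    using dis0 unfolding U_def disjoint_family_on_def by blast
  define N where "N = {A. closedin M A \<and>
      (\<forall>C \<in> \<F>. A \<inter> U C \<noteq> {}) \<and> (\<forall>C \<in> \<F>. A \<inter> M frontier_of U C = {})}"
  have cfr: "compactin M (M frontier_of U C)" if "C \<in> \<F>" for C
  proof (rule closed_compactin[OF K(1)])
    have "M closure_of U C \<subseteq> K"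
      using UK[OF that] K(2) by (rule closure_of_minimal)
    then show "M frontier_of U C \<subseteq> K"
      unfolding frontier_of_def by blast
  qed (rule closedin_frontier_of)
  have oN: "openin (chabauty_topology M) N"
  proof -
    \<comment> \<open>The factor \<open>topspace\<close> covers the case of empty \<open>Y\<close>,
      where \<open>\<F>\<close> is empty and the indexed intersection is the whole type.\<close>
    have "N = topspace (chabauty_topology M) \<inter>
        (\<Inter>C \<in> \<F>. {A. closedin M A \<and> A \<inter> U C \<noteq> {}} \<inter> {A. closedin M A \<and> A \<inter> M frontier_of U C = {}})"
      unfolding N_def topspace_chabauty_topology by auto
    also have "openin (chabauty_topology M) \<dots>"
      using finF openin_chabauty_hit[OF oU] openin_chabauty_miss[OF cfr]
      by (cases "\<F> = {}") (auto intro!: openin_Int openin_INT2)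
    finally show ?thesis .
  qed
  have YN: "Y \<in> N"
  proof -
    have "Y \<inter> U C \<noteq> {}" if "C \<in> \<F>" for C
      using CU[OF that] ne that UnF by (metis Int_subset_iff Union_upper subset_empty)
    \<comment> \<open>\<open>C\<close> lies in the open set \<open>U C\<close>, which is disjoint
      from its own frontier; any other component lies in an open set disjoint from
      \<open>U C\<close>, hence from its closure.\<close>
    moreover have "D \<inter> M frontier_of U C = {}" if "C \<in> \<F>" "D \<in> \<F>" for C D
    proof (cases "D = C")
      case True
      then show ?thesis
        using CU[OF that(1)] oU[OF that(1)] by (auto simp: frontier_of_def interior_of_openin)
    next
      case False
      then have "U D \<inter> U C = {}"
        using disU that by (simp add: disjoint_family_on_def)
      then have "U D \<inter> M closure_of U C = {}"
        using oU[OF that(2)] by (simp add: openin_Int_closure_of_eq_empty)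
      then show ?thesis
        using CU[OF that(2)] by (auto simp: frontier_of_def)
    qed
    ultimately show ?thesis
      unfolding N_def using compactin_imp_closedin[OF assms(2) cY] UnF by blast
  qed
  have translate: "\<phi> g ` Y \<subseteq> K" if g: "g \<in> carrier \<Gamma>" and gN: "\<phi> g ` Y \<in> N" for g
  proof -
    have "connectedin M (\<phi> g ` C)" if "C \<in> \<F>" for C
      using homeomorphic[OF g] conn[OF that]
      by (meson connectedin_continuous_map_image homeomorphic_imp_continuous_map)
    then have "\<phi> g ` \<Union>\<F> \<subseteq> \<Union>(U ` \<F>)"
      using gN unfolding N_def
      by (intro image_Union_subset_Union_of_frontiers[OF finF disU _ ne, of M]) (auto simp: UnF)
    then show ?thesis
      using UK UnF by blast
  qed
  have "A \<subseteq> K" if A: "A \<in> N \<inter> \<Y>" for A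
  proof (rule ccontr)
    assume "\<not> A \<subseteq> K"
    moreover have "A \<subseteq> topspace M"
      using A closedin_subset unfolding N_def by blast
    \<comment> \<open>Leaving the closed set \<open>K\<close> is an open condition, so by density
      some translate of \<open>Y\<close> in \<open>N\<close> would also leave \<open>K\<close>,
      against \<open>translate\<close>.\<close>
    ultimately have "(N \<inter> {A. closedin M A \<and> A \<inter> (topspace M - K) \<noteq> {}}) \<inter> \<Y> \<noteq> {}"
      using A unfolding N_def by blast
    moreover have "openin (chabauty_topology M)
        (N \<inter> {A. closedin M A \<and> A \<inter> (topspace M - K) \<noteq> {}})"
      using oN K(2) by (intro openin_Int openin_chabauty_hit) auto
    ultimately obtain g where "g \<in> carrier \<Gamma>"
      "\<phi> g ` Y \<in> N \<inter> {A. closedin M A \<and> A \<inter> (topspace M - K) \<noteq> {}}"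
      using minimal_meets_open[OF assms(4) _ _ Y] by metis
    then show False
      using translate by blast
  qed
  then show ?thesis
    using compactin_closure_of_Union[OF assms(2,4) oN _ K(1)] Y YN by blast
qed

end
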